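(* Let $\mathcal{K}\subset\mathbb{R}^N$ be a convex body and let $\varphi:[0,\infty)\to\mathbb{R}$ be an increasing function. Define $$\mu_\varphi(x)=\int_{\mathcal{K}}\varphi(|x-y|)\,dy,\qquad x\in\mathbb{R}^N,$$ and the set $\mathbf{m}(\mu_\varphi)=\{x\in\mathbb{R}^N:\mu_\varphi(x)=\min\mu_\varphi\}$. Then $$\mathbf{m}(\mu_\varphi)\cap\heartsuit(\mathcal{K})\neq\varnothing.$$
   Context: A convex body in $\mathbb{R}^N$ is a compact convex set with non-empty interior. "Increasing" means non-decreasing (not necessarily strictly). The minimum of $\mu_\varphi$ is over $\mathbb{R}^N$. For $\omega\in\mathbb{S}^{N-1}$ (the unit sphere) and $\lambda\in\mathbb{R}$, $T_{\lambda,\omega}$ is the reflection of $\mathbb{R}^N$ in the hyperplane $\{x:\langle x,\omega\rangle=\lambda\}$, and $\mathcal{K}_{\lambda,\omega}=\{x\in\mathcal{K}:\langle x,\omega\rangle\ge\lambda\}$. The maximal folding function is $\mathcal{R}_{\mathcal{K}}(\omega)=\min\{\lambda\in\mathbb{R}: T_{\lambda,\omega}(\mathcal{K}_{\lambda,\omega})\subseteq\mathcal{K}\}$. The heart of $\mathcal{K}$ is $\heartsuit(\mathcal{K})=\{x\in\mathcal{K}:\langle x,\omega\rangle\le\mathcal{R}_{\mathcal{K}}(\omega)\text{ for every }\omega\in\mathbb{S}^{N-1}\}$. *)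

theory Defs
  imports "HOL-Analysis.Analysis"
begin

definition convex_body :: "(real ^ 'n) set \<Rightarrow> bool" where
  "convex_body K \<longleftrightarrow> compact K \<and> convex K \<and> interior K \<noteq> {}"

definition mu :: "(real \<Rightarrow> real) \<Rightarrow> (real ^ 'n) set \<Rightarrow> real ^ 'n \<Rightarrow> real" where
  "mu \<phi> K x = (LINT y:K|lborel. \<phi> (norm (x - y)))"

definition minimizers :: "(real ^ 'n \<Rightarrow> real) \<Rightarrow> (real ^ 'n) set" where
  "minimizers f = {x. \<forall>y. f x \<le> f y}"

(* The reflection in the hyperplane {x. x \<bullet> w = l}; the formula presupposes norm w = 1. *)
definition refl_hyp :: "real \<Rightarrow> real ^ 'n \<Rightarrow> real ^ 'n \<Rightarrow> real ^ 'n" where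
  "refl_hyp l w x = x - (2 * (x \<bullet> w - l)) *\<^sub>R w"

definition cap :: "(real ^ 'n) set \<Rightarrow> real \<Rightarrow> real ^ 'n \<Rightarrow> (real ^ 'n) set" where
  "cap K l w = {x \<in> K. x \<bullet> w \<ge> l}"

(* LEAST is the minimum of the set of admissible l; it is attained for convex bodies and
   unit vectors, see max_folding_is_min below. *)
definition max_folding :: "(real ^ 'n) set \<Rightarrow> real ^ 'n \<Rightarrow> real" where
  "max_folding K w = (LEAST l. refl_hyp l w ` cap K l w \<subseteq> K)"

definition heart :: "(real ^ 'n) set \<Rightarrow> (real ^ 'n) set" where
  "heart K = {x \<in> K. \<forall>w \<in> sphere 0 1. x \<bullet> w \<le> max_folding K w}"

lemma max_folding_is_min:
  fixes K :: "(real ^ 'n) set"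
  assumes K: "convex_body K" and w: "w \<in> sphere 0 1"
  shows "refl_hyp (max_folding K w) w ` cap K (max_folding K w) w \<subseteq> K"
    and "\<And>l. refl_hyp l w ` cap K l w \<subseteq> K \<Longrightarrow> max_folding K w \<le> l"
proof -
  define S where "S = {l. refl_hyp l w ` cap K l w \<subseteq> K}"
  have cK: "compact K" and neK: "K \<noteq> {}"
    using K interior_subset by (auto simp: convex_body_def)
  have ww: "w \<bullet> w = 1" using w by (simp add: dot_square_norm)
  obtain B where B: "\<And>x. x \<in> K \<Longrightarrow> norm x \<le> B"
    using compact_imp_bounded[OF cK] by (auto simp: bounded_iff)
  have ip: "\<bar>x \<bullet> w\<bar> \<le> B" if "x \<in> K" for x
    using Cauchy_Schwarz_ineq2[of x w] B[OF that] w by simp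
  have "cap K (B + 1) w = {}" using ip by (force simp: cap_def)
  then have ne: "S \<noteq> {}" by (auto simp: S_def)
  have lb: "- B \<le> l" if "l \<in> S" for l
  proof (rule ccontr)
    assume l: "\<not> - B \<le> l"
    obtain x where x: "x \<in> K" using neK by blast
    have "x \<in> cap K l w" using x ip[OF x] l by (auto simp: cap_def)
    then have "refl_hyp l w x \<in> K" using that by (auto simp: S_def)
    then have "\<bar>refl_hyp l w x \<bullet> w\<bar> \<le> B" by (rule ip)
    moreover have "refl_hyp l w x \<bullet> w = 2 * l - x \<bullet> w"
      using ww by (simp add: refl_hyp_def inner_diff_left)
    ultimately show False using ip[OF x] l by linarith
  qed
  have bdd: "bdd_below S" using lb by (auto simp: bdd_below_def)
  have "closed S"
    unfolding closed_sequential_limits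
  proof (intro allI impI, elim conjE)
    fix f l assume f: "\<forall>n. f n \<in> S" and lim: "f \<longlonglongrightarrow> l"
    have "refl_hyp l w x \<in> K" if x: "x \<in> cap K l w" for x
    proof (cases "x \<bullet> w = l")
      case True
      then show ?thesis using x by (simp add: refl_hyp_def cap_def)
    next
      case False
      then have "l < x \<bullet> w" using x by (simp add: cap_def)
      then have "eventually (\<lambda>n. f n < x \<bullet> w) sequentially"
        using lim order_tendstoD(2) by blast
      then have ev: "eventually (\<lambda>n. refl_hyp (f n) w x \<in> K) sequentially"
      proof (rule eventually_mono)
        fix n assume "f n < x \<bullet> w"
        then have "x \<in> cap K (f n) w" using x by (simp add: cap_def)
        then show "refl_hyp (f n) w x \<in> K" using f by (auto simp: S_def)
      qed
      have "(\<lambda>n. refl_hyp (f n) w x) \<longlonglongrightarrow> refl_hyp l w x"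
        unfolding refl_hyp_def by (intro tendsto_intros lim)
      then show ?thesis
        using Lim_in_closed_set[OF compact_imp_closed[OF cK] ev] by simp
    qed
    then show "l \<in> S" by (auto simp: S_def)
  qed
  then have inS: "Inf S \<in> S" using closed_contains_Inf[OF ne bdd] by blast
  have least: "Inf S \<le> l" if "l \<in> S" for l using cInf_lower[OF that bdd] .
  have eq: "max_folding K w = Inf S"
    unfolding max_folding_def
    by (rule Least_equality) (use inS least in \<open>auto simp: S_def\<close>)
  show "refl_hyp (max_folding K w) w ` cap K (max_folding K w) w \<subseteq> K"
    using inS eq by (simp add: S_def)
  show "\<And>l. refl_hyp l w ` cap K l w \<subseteq> K \<Longrightarrow> max_folding K w \<le> l"
    using least eq by (simp add: S_def)
qed

end

theory Submission
  imports Defs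
begin

text \<open>
  Fold \<open>K\<close> along a hyperplane \<open>x \<bullet> w = l\<close> at or beyond the maximal folding level. The part of
  \<open>K\<close> above the hyperplane is mirrored into the part below, so \<open>K\<close> consists of a set symmetric
  in the hyperplane and a remainder below it. A function that is odd under the reflection and
  non-positive below the hyperplane therefore has a non-positive integral over \<open>K\<close>
  (\<open>set_integral_odd_nonpos\<close>). This principle is used twice. Applied to
  \<open>y \<mapsto> y \<bullet> w - l\<close> it puts the centroid of \<open>K\<close> on or below every maximal folding hyperplane
  (\<open>centroid_le_max_folding\<close>). Applied to \<open>y \<mapsto> \<phi> (norm (x' - y)) - \<phi> (norm (x - y))\<close>, where \<open>x\<close>
  lies above the hyperplane and \<open>x'\<close> is its mirror image, it shows that passing from \<open>x\<close> to
  \<open>x'\<close> does not increase \<open>mu \<phi> K\<close> (\<open>mu_refl_hyp_le\<close>).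

  Since \<open>\<phi>\<close> need not be strictly increasing, there may be minimizers outside the heart, and
  one has to be selected. The function \<open>mu \<phi> K\<close> is continuous, because a monotone function
  has countably many discontinuities and spheres are null sets; it attains its minimum, because
  projecting a point to \<open>K\<close> does not increase the value. So the set of minimizers is closed and
  non-empty and contains a point \<open>x\<close> nearest to the centroid. If \<open>x\<close> were strictly above some
  maximal folding hyperplane, its reflection in a parallel hyperplane strictly between \<open>x\<close> and that one would
  again be a minimizer, and strictly nearer to the centroid on the other side. Hence \<open>x\<close>
  satisfies all inequalities that define the heart, and these already force \<open>x\<close> into \<open>K\<close>, by
  separation.
\<close>

section \<open>Invariance of Lebesgue measure under reflections\<close>

text \<open>
  The argument is the uniqueness proof for translation-invariant measures. The integral of
  \<open>indicator A (x + f y) * indicator (ball 0 1) y\<close> over \<open>x\<close> and \<open>y\<close> is computed in two ways: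
  integrating over \<open>x\<close> first gives the measure of \<open>A\<close> times that of the ball; replacing \<open>y\<close>
  by \<open>y - inv f x\<close> before integrating over \<open>x\<close> gives the measure of the preimage of \<open>A\<close>
  times that of the ball, because \<open>f\<close> preserves the norm. The measure of the ball cancels.
\<close>

lemma lborel_distr_orthogonal_transformation:
  fixes f :: "'a::euclidean_space \<Rightarrow> 'a"
  assumes f: "orthogonal_transformation f"
  shows "distr lborel borel f = lborel"
proof (rule measure_eqI)
  have lin: "linear f" using f by (rule orthogonal_transformation_linear)
  have [measurable]: "f \<in> borel_measurable borel"
    using lin by (intro borel_measurable_continuous_onI linear_continuous_on)
      (simp add: linear_conv_bounded_linear)
  fix A assume "A \<in> sets (distr lborel borel f)"
  then have [measurable]: "A \<in> sets borel" by simp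
  have [measurable]: "ball (0::'a) 1 \<in> sets borel" by simp
  have [simp]: "f -` A \<in> sets borel"
    using measurable_sets[of f borel borel A] by simp
  define b where "b = emeasure lborel (ball (0::'a) 1)"
  have ball_shift: "emeasure lborel (ball z 1) = b" for z :: 'a
  proof -
    have "emeasure (distr lborel borel ((+) (- z))) (ball 0 1) = emeasure lborel (ball z 1)"
      by (subst emeasure_distr) (auto intro!: arg_cong[where f="emeasure lborel"] simp: dist_norm norm_minus_commute)
    then show ?thesis by (simp add: b_def lborel_distr_plus)
  qed
  have shift: "(\<integral>\<^sup>+y. g (c + y) \<partial>lborel) = (\<integral>\<^sup>+y. g y \<partial>lborel)"
    if [measurable]: "g \<in> borel_measurable borel" for g and c :: 'a
  proof -
    have "(\<integral>\<^sup>+y. g y \<partial>distr lborel borel ((+) c)) = (\<integral>\<^sup>+y. g (c + y) \<partial>lborel)"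
      by (rule nn_integral_distr) auto
    then show ?thesis by (simp add: lborel_distr_plus)
  qed
  have nf: "norm (f y) = norm y" for y using f by (rule orthogonal_transformation_norm)
  have *: "(\<integral>\<^sup>+y. indicator A (x + f y) * indicator (ball 0 1) y \<partial>lborel)
      = (\<integral>\<^sup>+y. indicator A (f y) * indicator (ball 0 1) (f y - x) \<partial>lborel :: ennreal)" for x
  proof -
    obtain z where z: "x = f z" using orthogonal_transformation_surj[OF f] by (metis surjD)
    have "(\<integral>\<^sup>+y. indicator A (x + f y) * indicator (ball 0 1) y \<partial>lborel)
      = (\<integral>\<^sup>+y. indicator A (f (z + y)) * indicator (ball 0 1) (f (z + y) - x) \<partial>lborel :: ennreal)"
      by (intro nn_integral_cong) (simp add: z linear_add[OF lin] nf indicator_def)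
    also have "\<dots> = (\<integral>\<^sup>+y. indicator A (f y) * indicator (ball 0 1) (f y - x) \<partial>lborel)"
      by (rule shift) measurable
    finally show ?thesis .
  qed
  have "b * emeasure lborel A
      = (\<integral>\<^sup>+y. emeasure lborel A * indicator (ball (0::'a) 1) y \<partial>lborel)"
    by (subst nn_integral_cmult_indicator) (auto simp: b_def mult.commute)
  also have "\<dots> = (\<integral>\<^sup>+y. (\<integral>\<^sup>+x. indicator A (x + f y) * indicator (ball 0 1) y \<partial>lborel) \<partial>lborel)"
  proof (rule nn_integral_cong)
    fix y
    have "(\<integral>\<^sup>+x. indicator A (x + f y) \<partial>lborel) = emeasure lborel A"
      using shift[of "indicator A" "f y"] by (simp add: add.commute)
    then show "emeasure lborel A * indicator (ball 0 1) y
      = (\<integral>\<^sup>+x. indicator A (x + f y) * indicator (ball 0 1) y \<partial>lborel)"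
      by (simp add: nn_integral_multc)
  qed
  also have "\<dots> = (\<integral>\<^sup>+x. (\<integral>\<^sup>+y. indicator A (x + f y) * indicator (ball 0 1) y \<partial>lborel) \<partial>lborel)"
    by (rule lborel_pair.Fubini') measurable
  also have "\<dots> = (\<integral>\<^sup>+x. (\<integral>\<^sup>+y. indicator A (f y) * indicator (ball 0 1) (f y - x) \<partial>lborel) \<partial>lborel)"
    by (simp only: *)
  also have "\<dots> = (\<integral>\<^sup>+y. (\<integral>\<^sup>+x. indicator A (f y) * indicator (ball 0 1) (f y - x) \<partial>lborel) \<partial>lborel)"
    by (rule lborel_pair.Fubini') measurable
  also have "\<dots> = (\<integral>\<^sup>+y. b * indicator (f -` A) y \<partial>lborel)"
  proof (rule nn_integral_cong)
    fix y
    have "indicator (ball 0 1) (f y - x) = (indicator (ball (f y) 1) x :: ennreal)" for x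
      by (simp add: indicator_def dist_norm norm_minus_commute)
    then have "(\<integral>\<^sup>+x. indicator A (f y) * indicator (ball 0 1) (f y - x) \<partial>lborel)
      = indicator A (f y) * emeasure lborel (ball (f y) 1)"
      by (simp add: nn_integral_cmult_indicator)
    then show "(\<integral>\<^sup>+x. indicator A (f y) * indicator (ball 0 1) (f y - x) \<partial>lborel)
      = b * indicator (f -` A) y"
      by (simp add: ball_shift indicator_def)
  qed
  also have "\<dots> = b * emeasure (distr lborel borel f) A"
    by (subst nn_integral_cmult_indicator) (simp_all add: emeasure_distr)
  finally have "b * emeasure lborel A = b * emeasure (distr lborel borel f) A" .
  moreover have "b < \<infinity>"
    unfolding b_def by (rule emeasure_bounded_finite) simp
  moreover have "b \<noteq> 0"
  proof
    assume "b = 0"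
    then have "ball (0::'a) 1 \<in> null_sets lborel" by (auto simp: b_def)
    then have "negligible (ball (0::'a) 1)"
      by (simp add: negligible_iff_null_sets null_sets_completionI)
    then show False using open_not_negligible[of "ball (0::'a) 1"] by auto
  qed
  ultimately show "emeasure (distr lborel borel f) A = emeasure lborel A"
    by (auto simp: ennreal_mult_cancel_left)
qed simp

lemma refl_hyp_inner:
  assumes "norm w = 1"
  shows "refl_hyp l w x \<bullet> w = 2 * l - x \<bullet> w"
  using assms by (simp add: refl_hyp_def inner_diff_left dot_square_norm)

lemma refl_hyp_involution:
  assumes "norm w = 1"
  shows "refl_hyp l w (refl_hyp l w x) = x"
proof -
  have "refl_hyp l w (refl_hyp l w x) = refl_hyp l w x - (2 * (l - x \<bullet> w)) *\<^sub>R w"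
    by (simp add: refl_hyp_def[of l w "refl_hyp l w x"] refl_hyp_inner[OF assms])
  also have "\<dots> = x - ((2 * (x \<bullet> w - l)) + (2 * (l - x \<bullet> w))) *\<^sub>R w"
    unfolding scaleR_add_left by (simp add: refl_hyp_def)
  finally show ?thesis by simp
qed

lemma refl_hyp_norm_diff:
  assumes "norm w = 1"
  shows "norm (refl_hyp l w x - refl_hyp l w y) = norm (x - y)"
proof -
  have "w \<bullet> w = 1" using assms by (simp add: dot_square_norm)
  then show ?thesis
    unfolding norm_eq refl_hyp_def by (simp add: algebra_simps inner_commute)
qed

lemma refl_hyp_dist_sqr:
  assumes "norm w = 1"
  shows "(norm (refl_hyp l w x - y))\<^sup>2 = (norm (x - y))\<^sup>2 + 4 * ((x \<bullet> w - l) * (y \<bullet> w - l))"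
proof -
  have "w \<bullet> w = 1" using assms by (simp add: dot_square_norm)
  then show ?thesis
    unfolding power2_norm_eq_inner refl_hyp_def by (simp add: algebra_simps inner_commute)
qed

lemma lborel_distr_refl_hyp:
  fixes w :: "real ^ 'n"
  assumes w: "norm w = 1"
  shows "distr lborel borel (refl_hyp l w) = lborel"
proof -
  define f where "f = (\<lambda>x. x - (2 * (x \<bullet> w)) *\<^sub>R w)"
  have "w \<bullet> w = 1" using w by (simp add: dot_square_norm)
  then have f: "orthogonal_transformation f"
    unfolding orthogonal_transformation_def f_def
    by (auto intro!: linearI simp: algebra_simps inner_commute)
  have [measurable]: "f \<in> borel_measurable borel"
    unfolding f_def by (intro borel_measurable_continuous_onI continuous_intros)
  have "refl_hyp l w = (+) ((2 * l) *\<^sub>R w) \<circ> f"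
    by (auto simp: refl_hyp_def f_def algebra_simps)
  then have "distr lborel borel (refl_hyp l w)
      = distr (distr lborel borel f) borel ((+) ((2 * l) *\<^sub>R w))"
    by (simp add: distr_distr)
  then show ?thesis
    by (simp add: lborel_distr_orthogonal_transformation[OF f] lborel_distr_plus)
qed

section \<open>The folding principle\<close>

text \<open>
  The reflection preserves Lebesgue measure, so adding to \<open>indicator K y * g y\<close> its composition
  with the reflection doubles the integral. The sum is pointwise non-positive: it vanishes where
  both or neither of a point and its mirror image belong to \<open>K\<close>, and if only one of them does,
  it is the lower one.
\<close>

lemma set_integral_odd_nonpos:
  fixes g :: "real ^ 'n \<Rightarrow> real"
  assumes w: "norm w = 1"
    and fold: "refl_hyp l w ` cap K l w \<subseteq> K"
    and int: "set_integrable lborel K g"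
    and odd: "\<And>y. g (refl_hyp l w y) = - g y"
    and below: "\<And>y. y \<bullet> w < l \<Longrightarrow> g y \<le> 0"
  shows "(LINT y:K|lborel. g y) \<le> 0"
proof -
  define h where "h = (\<lambda>y. indicat_real K y *\<^sub>R g y)"
  let ?T = "refl_hyp l w"
  have T[measurable]: "?T \<in> borel_measurable borel"
    unfolding refl_hyp_def[abs_def] by (intro borel_measurable_continuous_onI continuous_intros)
  have inth: "integrable lborel h" using int by (simp add: h_def set_integrable_def)
  then have [measurable]: "h \<in> borel_measurable borel" by simp
  have intT: "integrable lborel (\<lambda>y. h (?T y))"
    using inth integrable_distr_eq[of ?T lborel borel h]
    by (simp add: lborel_distr_refl_hyp[OF w])
  have eqT: "(LINT y|lborel. h (?T y)) = (LINT y|lborel. h y)"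
    using integral_distr[of ?T lborel borel h]
    by (simp add: lborel_distr_refl_hyp[OF w])
  have "h y + h (?T y) \<le> 0" for y
  proof -
    have up: "z \<in> K \<Longrightarrow> l \<le> z \<bullet> w \<Longrightarrow> ?T z \<in> K" for z
      using fold by (auto simp: cap_def)
    consider "y \<bullet> w < l" | "y \<bullet> w = l" | "y \<bullet> w > l" by linarith
    then show ?thesis
    proof cases
      case 1
      then have "?T y \<in> K \<Longrightarrow> y \<in> K"
        using up[of "?T y"] by (simp add: refl_hyp_inner[OF w] refl_hyp_involution[OF w])
      then show ?thesis using below[OF 1] by (auto simp: h_def odd indicator_def)
    next
      case 2
      then have "?T y = y" by (simp add: refl_hyp_def)
      then show ?thesis using odd[of y] by (simp add: h_def)
    next
      case 3
      then have "g (?T y) \<le> 0" by (intro below) (simp add: refl_hyp_inner[OF w])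
      then show ?thesis using up[of y] 3 by (auto simp: h_def odd indicator_def)
    qed
  qed
  then have "(LINT y|lborel. h y + h (?T y)) \<le> (LINT y::real ^ 'n|lborel. 0)"
    using inth intT by (intro integral_mono_AE) auto
  then show ?thesis
    using inth intT eqT by (simp add: h_def set_lebesgue_integral_def)
qed

text \<open>
  For \<open>y\<close> above both hyperplanes, the mirror image of \<open>y\<close> in the higher one lies on the segment
  from \<open>y\<close> to its mirror image in the lower one.
\<close>

lemma fold_subset_mono:
  fixes K :: "(real ^ 'n) set"
  assumes "convex K" and "refl_hyp m w ` cap K m w \<subseteq> K" and "m \<le> l"
  shows "refl_hyp l w ` cap K l w \<subseteq> K"
proof clarify
  fix y assume "y \<in> cap K l w"
  then have y: "y \<in> K" "l \<le> y \<bullet> w" by (auto simp: cap_def)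
  then have ym: "refl_hyp m w y \<in> K" using assms by (auto simp: cap_def)
  show "refl_hyp l w y \<in> K"
  proof (cases "y \<bullet> w = m")
    case True
    then show ?thesis using y assms by (simp add: refl_hyp_def)
  next
    case False
    define u where "u = (y \<bullet> w - l) / (y \<bullet> w - m)"
    have u: "0 \<le> u" "u \<le> 1" "u * (y \<bullet> w - m) = y \<bullet> w - l"
      using y assms False by (auto simp: u_def field_simps)
    have "refl_hyp l w y = (1 - u) *\<^sub>R y + u *\<^sub>R refl_hyp m w y"
      by (simp add: refl_hyp_def u(3)[symmetric] algebra_simps)
    then show ?thesis using convexD_alt[OF assms(1) y(1) ym u(1,2)] by simp
  qed
qed

lemma max_folding_fold:
  fixes K :: "(real ^ 'n) set"
  assumes "convex_body K" and "norm w = 1" and "max_folding K w \<le> l"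
  shows "refl_hyp l w ` cap K l w \<subseteq> K"
  using assms fold_subset_mono[of K "max_folding K w" w l] max_folding_is_min(1)[of K w]
  by (auto simp: convex_body_def)

text \<open>
  A hyperplane that strictly separates \<open>x\<close> from \<open>K\<close> cuts off an empty cap, so the maximal
  folding level in its normal direction is below \<open>x\<close>.
\<close>

lemma le_max_folding_imp_mem:
  fixes K :: "(real ^ 'n) set"
  assumes K: "convex_body K" and le: "\<And>w. norm w = 1 \<Longrightarrow> x \<bullet> w \<le> max_folding K w"
  shows "x \<in> K"
proof (rule ccontr)
  assume "x \<notin> K"
  moreover have "convex K" "closed K" "K \<noteq> {}"
    using K interior_subset by (auto simp: convex_body_def compact_imp_closed)
  ultimately obtain a b where ab: "a \<bullet> x < b" "\<And>y. y \<in> K \<Longrightarrow> b < a \<bullet> y"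
    using separating_hyperplane_closed_point[of K x] by auto
  then have "a \<noteq> 0" using \<open>K \<noteq> {}\<close> by fastforce
  define w where "w = - (a /\<^sub>R norm a)"
  have w: "norm w = 1" using \<open>a \<noteq> 0\<close> by (simp add: w_def)
  have "cap K (- b / norm a) w = {}"
    using ab(2) \<open>a \<noteq> 0\<close> by (force simp: cap_def w_def field_simps inner_commute)
  then have "max_folding K w \<le> - b / norm a"
    using max_folding_is_min(2)[OF K] w by simp
  also have "\<dots> < x \<bullet> w"
    using ab(1) \<open>a \<noteq> 0\<close> by (simp add: w_def field_simps inner_commute)
  finally show False using le[OF w] by simp
qed

definition centroid :: "(real ^ 'n) set \<Rightarrow> real ^ 'n" where
  "centroid K = (LINT y:K|lborel. y) /\<^sub>R measure lborel K"

lemma centroid_le_max_folding: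
  fixes K :: "(real ^ 'n) set"
  assumes K: "convex_body K" and w: "norm w = 1"
  shows "centroid K \<bullet> w \<le> max_folding K w"
proof -
  let ?l = "max_folding K w"
  have cK: "compact K" using K by (simp add: convex_body_def)
  have pos: "measure lborel K > 0"
  proof -
    have "\<not> negligible K"
      using K negligible_subset[OF _ interior_subset] open_not_negligible[OF open_interior]
      by (auto simp: convex_body_def)
    then have "measure lebesgue K \<noteq> 0"
      using negligible_iff_measure[of K] lmeasurable_compact[OF cK] by simp
    moreover have "measure lebesgue K = measure lborel K"
      using cK by (intro measure_completion) (simp add: borel_compact)
    ultimately show ?thesis by (simp add: less_le)
  qed
  have i: "set_integrable lborel K (\<lambda>y. y)"
    unfolding set_integrable_def by (rule borel_integrable_compact[OF cK]) (intro continuous_intros)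
  have i1: "set_integrable lborel K (\<lambda>y. y \<bullet> w)"
    unfolding set_integrable_def by (rule borel_integrable_compact[OF cK]) (intro continuous_intros)
  have ic: "set_integrable lborel K (\<lambda>y. ?l)"
    unfolding set_integrable_def by (rule borel_integrable_compact[OF cK]) (intro continuous_intros)
  have "(LINT y:K|lborel. y \<bullet> w - ?l) \<le> 0"
    by (rule set_integral_odd_nonpos[OF w max_folding_fold[OF K w order_refl]])
      (auto simp: refl_hyp_inner[OF w] i1 ic)
  then have "(LINT y:K|lborel. y \<bullet> w) \<le> ?l * measure lborel K"
    using i1 ic cK emeasure_compact_finite[OF cK]
    by (simp add: set_integral_diff set_integral_const borel_compact mult.commute)
  moreover have "(LINT y:K|lborel. y \<bullet> w) = (LINT y:K|lborel. y) \<bullet> w"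
    using i integral_inner_left[of w lborel "\<lambda>y. indicat_real K y *\<^sub>R y"]
    by (simp add: set_lebesgue_integral_def set_integrable_def)
  ultimately show ?thesis using pos by (simp add: centroid_def field_simps)
qed

section \<open>Minimizers of the radial potential\<close>

lemma mono_bound:
  fixes \<psi> :: "real \<Rightarrow> real"
  assumes "mono \<psi>" "0 \<le> t" "t \<le> r"
  shows "\<bar>\<psi> t\<bar> \<le> \<bar>\<psi> 0\<bar> + \<bar>\<psi> r\<bar>"
  using monoD[OF assms(1,2)] monoD[OF assms(1,3)] by linarith

lemma set_integrable_mono_norm:
  fixes K :: "(real ^ 'n) set" and \<psi> :: "real \<Rightarrow> real"
  assumes K: "compact K" and \<psi>: "mono \<psi>"
  shows "set_integrable lborel K (\<lambda>y. \<psi> (norm (x - y)))"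
proof -
  obtain B where B: "\<And>y. y \<in> K \<Longrightarrow> norm y \<le> B"
    using compact_imp_bounded[OF K] by (auto simp: bounded_iff)
  have [measurable]: "\<psi> \<in> borel_measurable borel" using \<psi> by (rule borel_measurable_mono)
  have "norm (\<psi> (norm (x - y))) \<le> \<bar>\<psi> 0\<bar> + \<bar>\<psi> (norm x + B)\<bar>" if "y \<in> K" for y
    using mono_bound[OF \<psi>, of "norm (x - y)" "norm x + B"] B[OF that] norm_triangle_ineq4[of x y]
    by simp
  then show ?thesis
    unfolding set_integrable_def using K emeasure_compact_finite[OF K]
    by (intro integrableI_bounded_set_indicator[where B="\<bar>\<psi> 0\<bar> + \<bar>\<psi> (norm x + B)\<bar>"])
      (auto simp: borel_compact)
qed

text \<open>
  By dominated convergence; the integrand converges except where \<open>norm (x - y)\<close> is one of the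
  countably many discontinuities of \<open>\<psi>\<close>, that is, except on countably many spheres around \<open>x\<close>.
\<close>

lemma isCont_mu:
  fixes K :: "(real ^ 'n) set" and \<psi> :: "real \<Rightarrow> real"
  assumes K: "compact K" and \<psi>: "mono \<psi>"
  shows "isCont (mu \<psi> K) x"
  unfolding continuous_at_sequentially o_def
proof (intro allI impI)
  fix X assume X: "X \<longlonglongrightarrow> x"
  obtain B where B: "\<And>y. y \<in> K \<Longrightarrow> norm y \<le> B"
    using compact_imp_bounded[OF K] by (auto simp: bounded_iff)
  obtain C where C: "\<And>n. norm (X n) \<le> C"
    using convergent_imp_Bseq[OF convergentI[OF X]] by (auto simp: Bseq_def)
  define M where "M = \<bar>\<psi> 0\<bar> + \<bar>\<psi> (C + B)\<bar>"
  have [measurable]: "K \<in> sets borel" using K by (rule borel_compact)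
  have [measurable]: "\<psi> \<in> borel_measurable borel" using \<psi> by (rule borel_measurable_mono)
  have null: "(\<Union>r\<in>{r. \<not> isCont \<psi> r}. sphere x r) \<in> null_sets lborel"
  proof (intro null_sets_UN' mono_ctble_discont[OF \<psi>])
    fix r
    show "sphere x r \<in> null_sets lborel"
      using negligible_sphere[of x r]
      by (simp add: negligible_iff_null_sets null_sets_completion_iff)
  qed
  have lim: "(\<lambda>n. indicat_real K y *\<^sub>R \<psi> (norm (X n - y))) \<longlonglongrightarrow> indicat_real K y *\<^sub>R \<psi> (norm (x - y))"
    if "y \<notin> (\<Union>r\<in>{r. \<not> isCont \<psi> r}. sphere x r)" for y
  proof -
    have "isCont \<psi> (norm (x - y))" using that by (auto simp: dist_norm)
    moreover have "(\<lambda>n. norm (X n - y)) \<longlonglongrightarrow> norm (x - y)" by (intro tendsto_intros X)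
    ultimately have "(\<lambda>n. \<psi> (norm (X n - y))) \<longlonglongrightarrow> \<psi> (norm (x - y))"
      by (rule isCont_tendsto_compose)
    then show ?thesis by (intro tendsto_intros)
  qed
  have bound: "norm (indicat_real K y *\<^sub>R \<psi> (norm (X n - y))) \<le> indicat_real K y *\<^sub>R M" for n y
    using mono_bound[OF \<psi>, of "norm (X n - y)" "C + B"] B[of y] C[of n]
      norm_triangle_ineq4[of "X n" y]
    by (auto simp: indicator_def M_def)
  show "(\<lambda>n. mu \<psi> K (X n)) \<longlonglongrightarrow> mu \<psi> K x"
    unfolding mu_def set_lebesgue_integral_def
  proof (rule integral_dominated_convergence[where w="\<lambda>y. indicat_real K y *\<^sub>R M"])
    show "integrable lborel (\<lambda>y. indicat_real K y *\<^sub>R M)"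
      by (rule borel_integrable_compact[OF K]) (intro continuous_intros)
    show "AE y in lborel. (\<lambda>n. indicat_real K y *\<^sub>R \<psi> (norm (X n - y)))
        \<longlonglongrightarrow> indicat_real K y *\<^sub>R \<psi> (norm (x - y))"
      using lim by (intro AE_I'[OF null]) auto
  qed (use bound in auto)
qed

lemma closed_minimizers:
  fixes f :: "real ^ 'n \<Rightarrow> real"
  assumes "\<And>x. isCont f x"
  shows "closed (minimizers f)"
proof -
  have "minimizers f = (\<Inter>y. {x. f x \<le> f y})" by (auto simp: minimizers_def)
  moreover have "closed {x. f x \<le> f y}" for y
    by (intro closed_Collect_le continuous_intros continuous_at_imp_continuous_on ballI assms)
  ultimately show ?thesis by auto
qed

lemma minimizers_mu_nonempty:
  fixes K :: "(real ^ 'n) set"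
  assumes K: "compact K" "convex K" "K \<noteq> {}" and \<psi>: "mono \<psi>"
  shows "minimizers (mu \<psi> K) \<noteq> {}"
proof -
  have cl: "closed K" using K by (simp add: compact_imp_closed)
  have proj: "mu \<psi> K (closest_point K z) \<le> mu \<psi> K z" for z
    unfolding mu_def
  proof (rule set_integral_mono)
    fix y assume "y \<in> K"
    then have "dist (closest_point K z) y \<le> dist z y"
      using closest_point_lipschitz[OF K(2) cl K(3), of z y] by (simp add: closest_point_self)
    then show "\<psi> (norm (closest_point K z - y)) \<le> \<psi> (norm (z - y))"
      by (intro monoD[OF \<psi>]) (simp add: dist_norm)
  qed (intro set_integrable_mono_norm K \<psi>)+
  have "continuous_on K (mu \<psi> K)"
    using isCont_mu[OF K(1) \<psi>] by (simp add: continuous_at_imp_continuous_on)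
  then obtain x where x: "\<And>y. y \<in> K \<Longrightarrow> mu \<psi> K x \<le> mu \<psi> K y"
    using continuous_attains_inf[OF K(1,3)] by blast
  have "mu \<psi> K x \<le> mu \<psi> K z" for z
    using x[OF closest_point_in_set[OF cl K(3), of z]] proj[of z] by linarith
  then show ?thesis by (auto simp: minimizers_def)
qed

lemma mu_refl_hyp_le:
  fixes K :: "(real ^ 'n) set"
  assumes K: "compact K" and \<psi>: "mono \<psi>" and w: "norm w = 1"
    and fold: "refl_hyp l w ` cap K l w \<subseteq> K" and x: "l \<le> x \<bullet> w"
  shows "mu \<psi> K (refl_hyp l w x) \<le> mu \<psi> K x"
proof -
  let ?T = "refl_hyp l w"
  let ?g = "\<lambda>y. \<psi> (norm (?T x - y)) - \<psi> (norm (x - y))"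
  note int = set_integrable_mono_norm[OF K \<psi>]
  have "(LINT y:K|lborel. ?g y) \<le> 0"
  proof (rule set_integral_odd_nonpos[OF w fold])
    show "set_integrable lborel K ?g" by (intro set_integral_diff int)
    show "?g (?T y) = - ?g y" for y
      using refl_hyp_norm_diff[OF w, of l "?T x" y] refl_hyp_norm_diff[OF w, of l x y]
      by (simp add: refl_hyp_involution[OF w])
    show "?g y \<le> 0" if "y \<bullet> w < l" for y
    proof -
      have "(x \<bullet> w - l) * (y \<bullet> w - l) \<le> 0"
        using that x by (simp add: mult_nonneg_nonpos)
      then have "(norm (?T x - y))\<^sup>2 \<le> (norm (x - y))\<^sup>2"
        using refl_hyp_dist_sqr[OF w, of l x y] by linarith
      then have "norm (?T x - y) \<le> norm (x - y)" by (rule power2_le_imp_le) simp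
      then show ?thesis using monoD[OF \<psi>] by simp
    qed
  qed
  then show ?thesis using int by (simp add: mu_def set_integral_diff)
qed

section \<open>A minimizer in the heart\<close>

lemma minimizer_in_heart:
  fixes K :: "(real ^ 'n) set" and \<psi> :: "real \<Rightarrow> real"
  assumes K: "convex_body K" and \<psi>: "mono \<psi>"
  shows "minimizers (mu \<psi> K) \<inter> heart K \<noteq> {}"
proof -
  let ?M = "minimizers (mu \<psi> K)" and ?c = "centroid K"
  have K': "compact K" "convex K" "K \<noteq> {}"
    using K interior_subset by (auto simp: convex_body_def)
  obtain x where x: "x \<in> ?M" and near: "\<And>y. y \<in> ?M \<Longrightarrow> dist ?c x \<le> dist ?c y"
    using distance_attains_inf[OF closed_minimizers[OF isCont_mu[OF K'(1) \<psi>]]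
        minimizers_mu_nonempty[OF K' \<psi>]] by blast
  have le: "x \<bullet> w \<le> max_folding K w" if w: "norm w = 1" for w
  proof (rule ccontr)
    assume above: "\<not> x \<bullet> w \<le> max_folding K w"
    \<comment> \<open>The level must lie strictly above the centroid, which may itself lie on the maximal
      folding hyperplane, as it does for a ball.\<close>
    define l where "l = (max_folding K w + x \<bullet> w) / 2"
    have l: "max_folding K w < l" "l < x \<bullet> w" using above by (auto simp: l_def)
    have "mu \<psi> K (refl_hyp l w x) \<le> mu \<psi> K x"
      using l by (intro mu_refl_hyp_le K' \<psi> w max_folding_fold K) auto
    then have "refl_hyp l w x \<in> ?M" using x by (auto simp: minimizers_def intro: order_trans)
    then have "norm (x - ?c) \<le> norm (refl_hyp l w x - ?c)"
      using near by (simp only: dist_norm norm_minus_commute[of ?c])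
    then have "(norm (x - ?c))\<^sup>2 \<le> (norm (refl_hyp l w x - ?c))\<^sup>2"
      by (intro power_mono) auto
    moreover have "(x \<bullet> w - l) * (?c \<bullet> w - l) < 0"
      using l centroid_le_max_folding[OF K w] by (intro mult_pos_neg) auto
    ultimately show False using refl_hyp_dist_sqr[OF w, of l x ?c] by linarith
  qed
  then have "x \<in> heart K"
    using le_max_folding_imp_mem[OF K] by (simp add: heart_def)
  then show ?thesis using x by blast
qed

theorem theorem3p8:
  fixes K :: "(real ^ 'n) set" and \<phi> :: "real \<Rightarrow> real"
  assumes "convex_body K"
    and "mono_on {0..} \<phi>"
  shows "minimizers (mu \<phi> K) \<inter> heart K \<noteq> {}"
proof -
  \<comment> \<open>Distances are non-negative, so \<open>\<phi>\<close> may be made constant on the negative half-line.\<close>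
  define \<psi> where "\<psi> = (\<lambda>t. \<phi> (max 0 t))"
  have "mono \<psi>"
    unfolding \<psi>_def by (intro monoI mono_onD[OF assms(2)]) auto
  moreover have "mu \<psi> K = mu \<phi> K"
    by (simp add: mu_def \<psi>_def fun_eq_iff)
  ultimately show ?thesis using minimizer_in_heart[OF assms(1), of \<psi>] by simp
qed

end
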